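(* Let $\mathcal{X}\subset\mathbb{R}^n$ be a closed convex set, $p>1$ an integer, $L_p>0$, $\tau\in(0,1)$, $\mu>0$. Let $F:\mathbb{R}^n\to\mathbb{R}^n$ be strongly monotone on $\mathcal{X}$ with modulus $\mu$, with $\|\nabla^{p-1}F(x)-\nabla^{p-1}F(y)\|\le L_p\|x-y\|$ for all $x,y\in\mathcal{X}$, and let $x^*$ be the unique element of $\mathrm{VI}_{\mathcal{X}}(F(x))$ (assumed nonempty). Let $x^k\in\mathcal{X}$, let $\tilde F(\cdot\,;x^k):\mathbb{R}^n\to\mathbb{R}^n$ satisfy $\|\tilde F(x;x^k)-F(x)\|\le\tau L_p\|x-x^k\|^p$ for all $x\in\mathcal{X}$, and let $$x^{k+0.5}\in\mathrm{VI}_{\mathcal{X}}\left(\tilde F(x;x^k)+L_p\|x-x^k\|^{p-1}(x-x^k)\right).$$ Then $$\|x^{k+0.5}-x^*\|\le\frac{(1+\tau)L_p}{\mu(1-\tau^2)^{\frac p2}}\,\|x^k-x^*\|^p .$$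
   Context: $\|\cdot\|$ is the Euclidean norm on $\mathbb{R}^n$ (and the corresponding operator norm for derivative tensors); $\nabla^{p-1}F$ is the $(p-1)$-th derivative of $F$, assumed to exist. For a mapping $T:\mathbb{R}^n\to\mathbb{R}^n$, $\mathrm{VI}_{\mathcal{X}}(T(x)):=\{x^*\in\mathcal{X}\mid \langle T(x^* ),x-x^*\rangle\ge0\ \text{for all }x\in\mathcal{X}\}$; in the subproblem defining $x^{k+0.5}$, $x$ is the variable and $x^k$ is fixed. $F$ is strongly monotone on $\mathcal{X}$ with modulus $\mu>0$ if $\langle F(x)-F(y),x-y\rangle\ge\mu\|x-y\|^2$ for all $x,y\in\mathcal{X}$. *)

theory Defs
  imports "HOL-Analysis.Analysis"
begin

definition VI :: "'a::real_inner set \<Rightarrow> ('a \<Rightarrow> 'a) \<Rightarrow> 'a set" where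
  "VI X T = {z \<in> X. \<forall>x\<in>X. T z \<bullet> (x - z) \<ge> 0}"

definition strongly_monotone_on :: "'a::real_inner set \<Rightarrow> ('a \<Rightarrow> 'a) \<Rightarrow> real \<Rightarrow> bool" where
  "strongly_monotone_on X F \<mu> \<longleftrightarrow>
     \<mu> > 0 \<and> (\<forall>x\<in>X. \<forall>y\<in>X. (F x - F y) \<bullet> (x - y) \<ge> \<mu> * (norm (x - y))\<^sup>2)"

text \<open>
  The \<open>k\<close>-th derivative at \<open>x\<close> is represented as the \<open>k\<close>-linear map sending a list
  \<open>[h\<^sub>1, \<dots>, h\<^sub>k]\<close> of directions to its value \<open>D\<^sup>kF(x)[h\<^sub>1, \<dots>, h\<^sub>k]\<close>; the order \<open>k\<close> is the
  length of the list.  It is obtained by differentiating \<open>y \<mapsto> D\<^sup>k\<^sup>-\<^sup>1F(y)[h\<^sub>2, \<dots>, h\<^sub>k]\<close> (in the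
  Frechet sense) and applying the result to \<open>h\<^sub>1\<close>.
\<close>

primrec nth_derivative ::
  "('a::euclidean_space \<Rightarrow> 'b::euclidean_space) \<Rightarrow> 'a list \<Rightarrow> 'a \<Rightarrow> 'b" where
  "nth_derivative F [] x = F x"
| "nth_derivative F (h # hs) x = frechet_derivative (nth_derivative F hs) (at x) h"

text \<open>
  As the spaces of multilinear maps are finite-dimensional, Frechet differentiability of the
  tensor-valued map \<open>x \<mapsto> D\<^sup>jF(x)\<close> is the same as that of all its evaluations at fixed
  directions.
\<close>

definition times_differentiable ::
  "nat \<Rightarrow> ('a::euclidean_space \<Rightarrow> 'b::euclidean_space) \<Rightarrow> bool" where
  "times_differentiable k F \<longleftrightarrow>
     (\<forall>hs x. length hs < k \<longrightarrow> nth_derivative F hs differentiable (at x))"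

definition tensor_norm ::
  "nat \<Rightarrow> ('a::euclidean_space list \<Rightarrow> 'b::euclidean_space) \<Rightarrow> real" where
  "tensor_norm k A = (SUP hs\<in>{hs. length hs = k \<and> (\<forall>h\<in>set hs. norm h \<le> 1)}. norm (A hs))"

end

theory Submission
  imports Defs
begin

text \<open>
  Adding the two variational inequalities at \<open>xhalf\<close> and \<open>xstar\<close> to strong monotonicity bounds
  \<open>\<mu> \<parallel>xhalf - xstar\<parallel>\<^sup>2\<close> by
  \<open>\<tau> L r\<^sup>p \<parallel>xhalf - xstar\<parallel> - L r\<^sup>p\<^sup>-\<^sup>1 (xhalf - xk) \<bullet> (xhalf - xstar)\<close>, where
  \<open>r = \<parallel>xhalf - xk\<parallel>\<close>.  By Cauchy-Schwarz this gives
  \<open>\<mu> \<parallel>xhalf - xstar\<parallel> \<le> (1 + \<tau>) L r\<^sup>p\<close>.  Moreover the bound is nonnegative, so the angle between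
  \<open>xhalf - xk\<close> and \<open>xhalf - xstar\<close> has cosine at most \<open>\<tau>\<close>; hence
  \<open>(1 - \<tau>\<^sup>2) r\<^sup>2 \<le> \<parallel>xk - xstar\<parallel>\<^sup>2\<close>.
\<close>

text \<open>Testing each inequality at the other solution gives both leftover terms a favourable
  sign, so only the perturbation \<open>F y - T y\<close> survives.\<close>

lemma strongly_monotone_VI_perturbed:
  fixes X :: "'a::real_inner set"
  assumes "strongly_monotone_on X F \<mu>" and "z \<in> VI X F" and "y \<in> VI X T"
  shows "\<mu> * (norm (y - z))\<^sup>2 \<le> (F y - T y) \<bullet> (y - z)"
proof -
  have "y \<in> X" "z \<in> X" "T y \<bullet> (z - y) \<ge> 0" "F z \<bullet> (y - z) \<ge> 0"
    using assms by (auto simp: VI_def)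
  moreover from this have "\<mu> * (norm (y - z))\<^sup>2 \<le> (F y - F z) \<bullet> (y - z)"
    using assms(1) by (auto simp: strongly_monotone_on_def)
  ultimately show ?thesis
    by (simp add: inner_diff_left inner_diff_right)
qed

text \<open>Expand \<open>norm (d - e)\<close> squared and complete the square in
  \<open>norm e\<close>; the worst case is \<open>norm e = \<tau> * norm d\<close>.\<close>

lemma norm_diff_ge_of_inner_le:
  fixes d e :: "'a::real_inner"
  assumes "d \<bullet> e \<le> \<tau> * norm d * norm e"
  shows "(1 - \<tau>\<^sup>2) * (norm d)\<^sup>2 \<le> (norm (d - e))\<^sup>2"
proof -
  have "0 \<le> (norm e - \<tau> * norm d)\<^sup>2" by simp
  also have "\<dots> = (norm e)\<^sup>2 - 2 * (\<tau> * norm d * norm e) + \<tau>\<^sup>2 * (norm d)\<^sup>2"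
    by (simp add: power2_eq_square algebra_simps)
  also have "\<dots> \<le> (norm e)\<^sup>2 - 2 * (d \<bullet> e) + \<tau>\<^sup>2 * (norm d)\<^sup>2"
    using assms by simp
  also have "\<dots> = (norm (d - e))\<^sup>2 - (1 - \<tau>\<^sup>2) * (norm d)\<^sup>2"
    by (simp add: power2_norm_eq_inner inner_diff inner_commute algebra_simps)
  finally show ?thesis by simp
qed

text \<open>Take square roots, then \<open>n\<close>-th powers; \<open>powr\<close> is needed since
  \<open>n\<close> may be odd.\<close>

lemma power_le_divide_powr_half:
  fixes c r s :: real
  assumes "0 < c" and "0 \<le> s" and "c * r\<^sup>2 \<le> s\<^sup>2" and "0 \<le> r"
  shows "r ^ n \<le> s ^ n / c powr (real n / 2)"
proof -
  have "sqrt c * r \<le> s"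
    by (rule power2_le_imp_le) (use assms in \<open>simp_all add: power_mult_distrib\<close>)
  then have "(sqrt c * r) ^ n \<le> s ^ n"
    using assms by (intro power_mono) auto
  moreover have "sqrt c ^ n = c powr (real n / 2)"
  proof -
    have "sqrt c ^ n = sqrt c powr real n"
      using assms(1) by (subst powr_realpow) auto
    also have "\<dots> = (c powr (1 / 2)) powr real n"
      using assms(1) by (subst powr_half_sqrt) auto
    finally show ?thesis by (simp only: powr_powr times_divide_eq_left mult_1)
  qed
  ultimately show ?thesis
    using assms(1) by (simp add: power_mult_distrib pos_le_divide_eq mult.commute)
qed

theorem mainTheorem4:
  fixes X :: "(real ^ 'n) set"
    and F Ft :: "real ^ 'n \<Rightarrow> real ^ 'n"
    and p :: nat and L \<tau> \<mu> :: real
    and xstar xk xhalf :: "real ^ 'n"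
  assumes "closed X" and "convex X"
    and "p > 1" and "L > 0" and "0 < \<tau>" and "\<tau> < 1" and "\<mu> > 0"
    and "strongly_monotone_on X F \<mu>"
    and "times_differentiable (p - 1) F"
    and "\<forall>x\<in>X. \<forall>y\<in>X.
           tensor_norm (p - 1) (\<lambda>hs. nth_derivative F hs x - nth_derivative F hs y)
             \<le> L * norm (x - y)"
    and "xstar \<in> VI X F"
    and "xk \<in> X"
    and "\<forall>x\<in>X. norm (Ft x - F x) \<le> \<tau> * L * norm (x - xk) ^ p"
    and "xhalf \<in> VI X (\<lambda>x. Ft x + (L * norm (x - xk) ^ (p - 1)) *\<^sub>R (x - xk))"
  shows "norm (xhalf - xstar)
           \<le> (1 + \<tau>) * L / (\<mu> * (1 - \<tau>\<^sup>2) powr (real p / 2)) * norm (xk - xstar) ^ p"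
proof -
  define d e where "d = xhalf - xk" and "e = xhalf - xstar"
  have "xhalf \<in> X"
    using assms(14) by (simp add: VI_def)
  have p: "norm d ^ p = norm d ^ (p - 1) * norm d"
    using \<open>p > 1\<close> by (simp add: power_eq_if)
  have "(F xhalf - Ft xhalf) \<bullet> e \<le> norm (Ft xhalf - F xhalf) * norm e"
    using norm_cauchy_schwarz[of "F xhalf - Ft xhalf" e] by (simp add: norm_minus_commute)
  also have "\<dots> \<le> \<tau> * L * norm d ^ p * norm e"
    using assms(13) \<open>xhalf \<in> X\<close> by (intro mult_right_mono) (auto simp: d_def)
  finally have err: "(F xhalf - Ft xhalf) \<bullet> e \<le> \<tau> * L * norm d ^ p * norm e" .
  have "\<mu> * (norm e)\<^sup>2 \<le> (F xhalf - Ft xhalf) \<bullet> e - L * norm d ^ (p - 1) * (d \<bullet> e)"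
    using strongly_monotone_VI_perturbed[OF assms(8,11,14)]
    by (simp add: d_def e_def inner_diff_left inner_add_left algebra_simps)
  with err have key: "\<mu> * (norm e)\<^sup>2 \<le> L * norm d ^ (p - 1) * (\<tau> * norm d * norm e - d \<bullet> e)"
    by (simp add: p algebra_simps)
  \<comment> \<open>For \<open>d = 0\<close> both sides vanish; otherwise the positive factor
    \<open>L * norm d ^ (p - 1)\<close> cancels from \<open>key\<close>.\<close>
  have angle: "d \<bullet> e \<le> \<tau> * norm d * norm e"
  proof (cases "d = 0")
    case False
    have "0 \<le> \<mu> * (norm e)\<^sup>2"
      using \<open>\<mu> > 0\<close> by simp
    with key have "0 \<le> L * norm d ^ (p - 1) * (\<tau> * norm d * norm e - d \<bullet> e)"
      by linarith
    moreover have "0 < L * norm d ^ (p - 1)"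
      using False \<open>L > 0\<close> by simp
    ultimately show ?thesis
      by (simp add: zero_le_mult_iff)
  qed simp
  have "norm d ^ p \<le> norm (d - e) ^ p / (1 - \<tau>\<^sup>2) powr (real p / 2)"
    using norm_diff_ge_of_inner_le[OF angle] \<open>0 < \<tau>\<close> \<open>\<tau> < 1\<close>
    by (intro power_le_divide_powr_half) (auto simp: power_less_one_iff)
  \<comment> \<open>Here \<open>d - e = xstar - xk\<close>, so \<open>xhalf\<close> drops out of the
    right-hand side.\<close>
  then have step: "norm d ^ p \<le> norm (xk - xstar) ^ p / (1 - \<tau>\<^sup>2) powr (real p / 2)"
    by (simp add: d_def e_def norm_minus_commute)
  have "\<mu> * norm e \<le> (1 + \<tau>) * L * norm d ^ p"
  proof (cases "e = 0")
    case False
    \<comment> \<open>Cauchy-Schwarz for \<open>- d\<close> supplies the \<open>1\<close> in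
      \<open>1 + \<tau>\<close>; one factor \<open>norm e\<close> is then cancelled.\<close>
    have "- (d \<bullet> e) \<le> norm d * norm e"
      using norm_cauchy_schwarz[of "- d" e] by simp
    then have "L * norm d ^ (p - 1) * (\<tau> * norm d * norm e - d \<bullet> e)
        \<le> L * norm d ^ (p - 1) * (\<tau> * norm d * norm e + norm d * norm e)"
      using \<open>L > 0\<close> by (intro mult_left_mono) auto
    with key have "(\<mu> * norm e) * norm e \<le> ((1 + \<tau>) * L * norm d ^ p) * norm e"
      by (simp add: p power2_eq_square algebra_simps)
    with False show ?thesis by simp
  qed (use \<open>0 < \<tau>\<close> \<open>L > 0\<close> in simp)
  also have "\<dots> \<le> (1 + \<tau>) * L * (norm (xk - xstar) ^ p / (1 - \<tau>\<^sup>2) powr (real p / 2))"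
    using step \<open>0 < \<tau>\<close> \<open>L > 0\<close> by (intro mult_left_mono) auto
  finally have "norm e
      \<le> (1 + \<tau>) * L * (norm (xk - xstar) ^ p / (1 - \<tau>\<^sup>2) powr (real p / 2)) / \<mu>"
    using \<open>\<mu> > 0\<close> by (simp only: pos_le_divide_eq mult.commute[of "norm e"])
  then show ?thesis
    by (simp add: e_def mult.commute)
qed

end
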